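(* Let $D$ be a knot diagram, let $2\le k<\infty$, and let $M$ be the game matrix over $\mathbb{Z}_k$ of any version of the $k$-color region select game on $D$. Then $|Ker_k(M)|=k^2$.
   Context: Diagrams: a link (knot) diagram $D$ is the underlying graph of a regular projection of a link (knot) into $S^2$. Its vertices are the crossings, each of valence 4, and over/under information is ignored. Components without crossings are closed loops, each regarded as one edge with no vertices. Regions of $D$ are the connected components of $S^2\setminus D$. A vertex or edge is incident to a region if it lies in the boundary of that region. Two regions are adjacent if they are incident to a common edge. A vertex $v$ is reducible if some circle in $S^2$ meets $D$ transversely only at $v$, and irreducible otherwise. An irreducible vertex is incident to four distinct regions. A reducible vertex $v$ is incident to exactly three regions $r_0,r_1,r_2$, where $r_0$ touches $v$ from two sides and $r_1,r_2$ touch it from one side. A knot diagram with $n$ vertices has $n+2$ regions. A knot diagram is reduced if all its vertices are irreducible. Ring: for an integer $k\ge2$ let $\mathbb{Z}_k=\mathbb{Z}/k\mathbb{Z}$, and for $k=\infty$ let $\mathbb{Z}_\infty=\mathbb{Z}$. Game versions: a version of the $k$-color region select game on $D$ is a choice of an increment number $a(v,r)\in\mathbb{Z}_k$ for every incident vertex–region pair, subject to the following rules. - If $k<\infty$ and $v$ is irreducible, then $a(v,r)=a_v$ is the same for all regions $r$ incident to $v$, and $a_v$ is not a zero divisor of $\mathbb{Z}_k$. - If $k<\infty$ and $v$ is reducible, then $a(v,r_0)$ is arbitrary, while $a(v,r_1)$ and $a(v,r_2)$ are not zero divisors. - If $k=\infty$, then $a(v,r)=1$, except that $a(v,r_0)\in\mathbb{Z}$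 is arbitrary when $v$ is reducible. - The original game is the version in which all increment numbers equal $1$. Game matrix: enumerate the vertices as $v_1,\dots,v_n$ and the regions as $r_1,\dots,r_m$. The game matrix is the $n\times m$ matrix $M$ over $\mathbb{Z}_k$ with $M_{ij}=a(v_i,r_j)$ if $v_i$ is incident to $r_j$, and $M_{ij}=0$ otherwise. Patterns and configurations: a push pattern is a vector $\mathbf p\in\mathbb{Z}_k^m$, and $\mathbf p(r_j)=p_j$ is the number of times $r_j$ is pushed. A region $r$ is not pushed in $\mathbf p$ if $\mathbf p(r)=0$. A color configuration is a vector $\mathbf c\in\mathbb{Z}_k^n$. Applying $\mathbf p$ to $\mathbf c$ yields $\mathbf c+M\mathbf p$. The configuration $\mathbf c$ is solvable if some $\mathbf p$ satisfies $M\mathbf p=-\mathbf c$; such a $\mathbf p$ is a solving pattern for $\mathbf c$. $D$ is always solvable in the version if every $\mathbf c\in\mathbb{Z}_k^n$ is solvable. A null pattern is an element of $Ker_k(M)=\{\mathbf p\in\mathbb{Z}_k^m: M\mathbf p=0\}$. *)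

theory Defs
  imports "HOL-Combinatorics.Permutations" "HOL-Library.FuncSet"
begin

(* Combinatorial model of a knot diagram on S^2 as a combinatorial map
   (rotation system) on a finite set H of darts (half-edges):
     alpha : fixed-point-free involution pairing the two ends of each edge,
     sigma : rotation (cyclic order) of the darts around each crossing.
   Vertices = sigma-orbits, edges = alpha-orbits, regions = orbits of sigma o alpha.
   The case H = {} encodes the crossingless diagram (a single closed loop),
   which has no vertices and exactly two regions. *)

definition orbit_of :: "('d \<Rightarrow> 'd) \<Rightarrow> 'd \<Rightarrow> 'd set" where
  "orbit_of f x = {(f ^^ n) x | n. True}"

definition orbits_on :: "('d \<Rightarrow> 'd) \<Rightarrow> 'd set \<Rightarrow> 'd set set" where
  "orbits_on f H = orbit_of f ` H"

definition vertices :: "'d set \<Rightarrow> ('d \<Rightarrow> 'd) \<Rightarrow> 'd set set" where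
  "vertices H sigma = orbits_on sigma H"

definition edges :: "'d set \<Rightarrow> ('d \<Rightarrow> 'd) \<Rightarrow> 'd set set" where
  "edges H alpha = orbits_on alpha H"

definition faces :: "'d set \<Rightarrow> ('d \<Rightarrow> 'd) \<Rightarrow> ('d \<Rightarrow> 'd) \<Rightarrow> 'd set set" where
  "faces H alpha sigma = orbits_on (sigma \<circ> alpha) H"

(* regions of the diagram; Inr False / Inr True are the two regions of the
   crossingless loop *)
definition regions :: "'d set \<Rightarrow> ('d \<Rightarrow> 'd) \<Rightarrow> ('d \<Rightarrow> 'd) \<Rightarrow> ('d set + bool) set" where
  "regions H alpha sigma =
     (if H = {} then {Inr False, Inr True} else Inl ` faces H alpha sigma)"

fun incident :: "'d set \<Rightarrow> ('d set + bool) \<Rightarrow> bool" where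
  "incident v (Inl f) = (v \<inter> f \<noteq> {})"
| "incident v (Inr _) = False"

fun corners :: "'d set \<Rightarrow> ('d set + bool) \<Rightarrow> nat" where
  "corners v (Inl f) = card (v \<inter> f)"
| "corners v (Inr _) = 0"

(* v is reducible iff some region touches v from two sides (equivalently,
   a circle can be drawn through that region meeting D only at v) *)
definition reducible :: "'d set \<Rightarrow> ('d \<Rightarrow> 'd) \<Rightarrow> ('d \<Rightarrow> 'd) \<Rightarrow> 'd set \<Rightarrow> bool" where
  "reducible H alpha sigma v = (\<exists>r \<in> regions H alpha sigma. incident v r \<and> corners v r \<ge> 2)"

(* A knot diagram: 4-valent crossings, planar (Euler characteristic 2),
   exactly one component (the straight-ahead permutation sigma^2 o alpha has
   exactly two orbits, the two orientations of the single component). *)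
definition knot_diagram :: "'d set \<Rightarrow> ('d \<Rightarrow> 'd) \<Rightarrow> ('d \<Rightarrow> 'd) \<Rightarrow> bool" where
  "knot_diagram H alpha sigma \<longleftrightarrow>
     finite H \<and> alpha permutes H \<and> sigma permutes H \<and>
     (\<forall>d\<in>H. alpha d \<noteq> d \<and> alpha (alpha d) = d) \<and>
     (\<forall>d\<in>H. card (orbit_of sigma d) = 4) \<and>
     (H \<noteq> {} \<longrightarrow>
        card (orbits_on ((sigma ^^ 2) \<circ> alpha) H) = 2 \<and>
        card (vertices H sigma) + card (faces H alpha sigma)
          = card (edges H alpha) + 2)"

definition zero_divisor_mod :: "nat \<Rightarrow> int \<Rightarrow> bool" where
  "zero_divisor_mod k a \<longleftrightarrow> (\<exists>b::int. b mod int k \<noteq> 0 \<and> (a * b) mod int k = 0)"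

(* a version of the k-colour region select game (k finite): increment numbers
   a v r (read modulo k) for incident vertex-region pairs *)
definition game_version ::
  "'d set \<Rightarrow> ('d \<Rightarrow> 'd) \<Rightarrow> ('d \<Rightarrow> 'd) \<Rightarrow> nat \<Rightarrow> ('d set \<Rightarrow> ('d set + bool) \<Rightarrow> int) \<Rightarrow> bool" where
  "game_version H alpha sigma k a \<longleftrightarrow>
     (\<forall>v \<in> vertices H sigma.
        (\<not> reducible H alpha sigma v \<longrightarrow>
           (\<forall>r \<in> regions H alpha sigma. \<forall>r' \<in> regions H alpha sigma.
              incident v r \<and> incident v r' \<longrightarrow> a v r mod int k = a v r' mod int k) \<and>
           (\<forall>r \<in> regions H alpha sigma. incident v r \<longrightarrow> \<not> zero_divisor_mod k (a v r))) \<and>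
        (reducible H alpha sigma v \<longrightarrow>
           (\<forall>r \<in> regions H alpha sigma. incident v r \<and> corners v r = 1
              \<longrightarrow> \<not> zero_divisor_mod k (a v r))))"

definition game_matrix :: "('d set \<Rightarrow> ('d set + bool) \<Rightarrow> int) \<Rightarrow> 'd set \<Rightarrow> ('d set + bool) \<Rightarrow> int" where
  "game_matrix a v r = (if incident v r then a v r else 0)"

definition kernel_k ::
  "'d set \<Rightarrow> ('d \<Rightarrow> 'd) \<Rightarrow> ('d \<Rightarrow> 'd) \<Rightarrow> nat \<Rightarrow> ('d set \<Rightarrow> ('d set + bool) \<Rightarrow> int)
     \<Rightarrow> (('d set + bool) \<Rightarrow> int) set" where
  "kernel_k H alpha sigma k a =
     {p \<in> regions H alpha sigma \<rightarrow>\<^sub>E {0..<int k}.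
        \<forall>v \<in> vertices H sigma.
          (\<Sum>r \<in> regions H alpha sigma. game_matrix a v r * p r) mod int k = 0}"

end

theory Submission
  imports Defs
begin

text \<open>
  Null patterns are bounded by propagation. If every crossing carries the weights of the
  original game, counted with multiplicity at the corners, then the sum of the pushes of the two
  regions along an edge changes sign from each edge to the next one along the knot. Hence a null
  pattern that vanishes on both sides of one edge has all these sums zero, and so vanishes on
  all regions. Together with the pigeonhole bound from \<open>n + 2\<close> regions against \<open>n\<close> crossings,
  null patterns are in bijection with their values on the two sides of any edge. At irreducible
  crossings the increment number cancels. A reducible crossing with other weights is normalized,
  one crossing at a time: it separates the diagram into two sides, and a null pattern can be kept
  on one side while it is replaced on the other side by a null pattern for the normalized
  weights. The separation comes from planarity in the form that every cycle mod 2 of the dual map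
  is a cut, which follows from Euler's formula by counting.
\<close>

section \<open>Orbits of a permutation of a finite set\<close>

lemma orbit_of_refl: "x \<in> orbit_of f x"
  unfolding orbit_of_def by (auto intro: exI[of _ 0])

lemma orbit_of_least:
  assumes "x \<in> X" and "\<And>d. d \<in> X \<Longrightarrow> d \<in> orbit_of f x \<Longrightarrow> f d \<in> X"
  shows "orbit_of f x \<subseteq> X"
proof -
  have "(f ^^ n) x \<in> X" for n
    using assms by (induction n) (auto simp: orbit_of_def)
  then show ?thesis by (auto simp: orbit_of_def)
qed

locale finite_perm =
  fixes f :: "'d \<Rightarrow> 'd" and H :: "'d set"
  assumes fin: "finite H" and perm: "f permutes H"
begin

text \<open>Orbits use only nonnegative powers, so the way back from \<open>y\<close> to
  \<open>x\<close> comes from a positive power of \<open>f\<close> that fixes \<open>x\<close>: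
  \<open>N * n\<close> steps return to \<open>x\<close>, and \<open>N * n - n\<close> of them start
  at \<open>y\<close>.\<close>

lemma orbit_of_eq:
  assumes "y \<in> orbit_of f x"
  shows "orbit_of f y = orbit_of f x"
proof -
  obtain n where y: "y = (f ^^ n) x" using assms by (auto simp: orbit_of_def)
  obtain N where N: "N > 0" "(f ^^ N) x = x"
    using permutation_self[of f x] fin perm permutation_permutes by metis
  have per: "(f ^^ (N * m)) x = x" for m
    by (induction m) (use N in \<open>simp_all add: funpow_add\<close>)
  have "n \<le> N * n" using N by simp
  then have x: "(f ^^ (N * n - n)) y = x"
    unfolding y using per[of n] by (simp flip: funpow_add[THEN fun_cong, unfolded o_def])
  have sub: "orbit_of f ((f ^^ m) z) \<subseteq> orbit_of f z" for m z
    by (auto simp: orbit_of_def simp flip: funpow_add[THEN fun_cong, unfolded o_def])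
  show ?thesis using sub[of n x] sub[of "N * n - n" y] unfolding x y[symmetric] by blast
qed

lemma orbit_of_image [simp]: "orbit_of f (f x) = orbit_of f x"
  by (rule orbit_of_eq) (auto simp: orbit_of_def intro: exI[of _ 1])

lemma image_in [simp]: "f x \<in> H \<longleftrightarrow> x \<in> H"
  using perm by (simp add: permutes_in_image)

lemma image_eq [simp]: "f x = f y \<longleftrightarrow> x = y"
  using perm by (simp add: permutes_inj inj_eq)

lemma orbit_of_subset: "x \<in> H \<Longrightarrow> orbit_of f x \<subseteq> H"
  by (rule orbit_of_least) auto

lemma in_orbit_of_iff: "y \<in> orbit_of f x \<longleftrightarrow> orbit_of f y = orbit_of f x"
  using orbit_of_eq orbit_of_refl by metis

text \<open>Unions of orbits. For \<open>sigma\<close>, \<open>alpha\<close> and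
  \<open>sigma \<circ> alpha\<close> they encode sets of crossings, edges and regions, added mod 2
  by symmetric difference.\<close>

definition invariant_sets :: "'d set set" where
  "invariant_sets = {S. S \<subseteq> H \<and> (\<forall>d\<in>H. f d \<in> S \<longleftrightarrow> d \<in> S)}"

lemma orbit_in_invariant:
  assumes "S \<in> invariant_sets" and "d \<in> S"
  shows "orbit_of f d \<subseteq> S"
  by (rule orbit_of_least) (use assms in \<open>auto simp: invariant_sets_def\<close>)

lemma orbit_of_invariant: "d \<in> H \<Longrightarrow> orbit_of f d \<in> invariant_sets"
  using orbit_of_subset by (auto simp: invariant_sets_def in_orbit_of_iff)

text \<open>The orbit of \<open>f d\<close> passes through \<open>d\<close> again, so closure
  forwards gives closure backwards.\<close>

lemma closed_imp_invariant:
  assumes "S \<subseteq> H" and "\<And>d. d \<in> S \<Longrightarrow> f d \<in> S"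
  shows "S \<in> invariant_sets"
proof -
  have "d \<in> S" if "f d \<in> S" for d
  proof -
    have "orbit_of f (f d) \<subseteq> S" by (rule orbit_of_least) (use assms that in auto)
    then show ?thesis using orbit_of_refl[of d f] by auto
  qed
  then show ?thesis using assms unfolding invariant_sets_def by blast
qed

lemma invariant_eq_Union:
  assumes "S \<in> invariant_sets"
  shows "S = \<Union> (orbits_on f S)"
  using orbit_in_invariant[OF assms] orbit_of_refl by (fastforce simp: orbits_on_def)

lemma finite_orbits: "S \<subseteq> H \<Longrightarrow> finite (orbits_on f S)"
  using fin by (auto simp: orbits_on_def intro: finite_subset)

lemma card_invariant_sets: "card invariant_sets = 2 ^ card (orbits_on f H)"
proof -
  have "bij_betw (orbits_on f) invariant_sets (Pow (orbits_on f H))"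
  proof (rule bij_betw_byWitness[where f' = Union])
    show "\<forall>S\<in>invariant_sets. \<Union> (orbits_on f S) = S"
      using invariant_eq_Union by blast
    show "\<forall>P\<in>Pow (orbits_on f H). orbits_on f (\<Union> P) = P"
    proof
      fix P assume P: "P \<in> Pow (orbits_on f H)"
      have "orbit_of f d = Q" if "Q \<in> P" "d \<in> Q" for d Q
        using that P by (auto simp: orbits_on_def in_orbit_of_iff)
      moreover have "Q \<noteq> {}" if "Q \<in> P" for Q
        using that P orbit_of_refl by (fastforce simp: orbits_on_def)
      ultimately show "orbits_on f (\<Union> P) = P"
        by (fastforce simp: orbits_on_def image_iff)
    qed
    show "orbits_on f ` invariant_sets \<subseteq> Pow (orbits_on f H)"
      by (auto simp: invariant_sets_def orbits_on_def)
    show "Union ` Pow (orbits_on f H) \<subseteq> invariant_sets"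
    proof clarify
      fix P assume P: "P \<subseteq> orbits_on f H"
      then have "P \<subseteq> invariant_sets" by (auto simp: orbits_on_def orbit_of_invariant)
      then show "\<Union> P \<in> invariant_sets" by (auto simp: invariant_sets_def)
    qed
  qed
  then have "card invariant_sets = card (Pow (orbits_on f H))" by (rule bij_betw_same_card)
  then show ?thesis by (simp add: card_Pow finite_orbits)
qed

lemma card_eq_orbits:
  assumes "S \<in> invariant_sets" and "\<And>d. d \<in> S \<Longrightarrow> card (orbit_of f d) = m"
  shows "card S = m * card (orbits_on f S)"
proof -
  have SH: "S \<subseteq> H" using assms(1) by (simp add: invariant_sets_def)
  have "card (\<Union> (orbits_on f S)) = (\<Sum>Q\<in>orbits_on f S. card Q)"
  proof (rule card_Union_disjoint)
    show "pairwise disjnt (orbits_on f S)"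
      by (auto simp: pairwise_def disjnt_def orbits_on_def in_orbit_of_iff)
    show "finite Q" if "Q \<in> orbits_on f S" for Q
      using that SH orbit_of_subset fin by (auto simp: orbits_on_def intro: finite_subset)
  qed
  also have "\<dots> = m * card (orbits_on f S)"
  proof -
    have "card Q = m" if "Q \<in> orbits_on f S" for Q
      using that assms(2) by (auto simp: orbits_on_def)
    then show ?thesis by simp
  qed
  finally show ?thesis using invariant_eq_Union[OF assms(1)] by argo
qed

end

section \<open>Counting by fibres and parity\<close>

lemma card_eq_sum_fibres:
  assumes "finite A"
  shows "card A = (\<Sum>y\<in>f ` A. card {x \<in> A. f x = y})"
  using sum.image_gen[OF assms, of "\<lambda>_. 1::nat" f] by simp

text \<open>Together with the next lemma this stands in for rank-nullity: a bound on the fibres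
  bounds the image or, when \<open>m\<close> is the size of a kernel, the kernel.\<close>

lemma card_le_fibres:
  assumes "finite A" and "\<And>y. y \<in> f ` A \<Longrightarrow> card {x \<in> A. f x = y} \<le> m"
  shows "card A \<le> m * card (f ` A)"
  using sum_bounded_above[of "f ` A" "\<lambda>y. card {x \<in> A. f x = y}" m] assms
  by (simp add: card_eq_sum_fibres[OF assms(1), of f] mult.commute)

lemma card_ge_fibres:
  assumes "finite A" and "\<And>y. y \<in> f ` A \<Longrightarrow> m \<le> card {x \<in> A. f x = y}"
  shows "m * card (f ` A) \<le> card A"
  using sum_bounded_below[of "f ` A" m "\<lambda>y. card {x \<in> A. f x = y}"] assms
  by (simp add: card_eq_sum_fibres[OF assms(1), of f] mult.commute)

text \<open>Common elements are counted twice in \<open>card A + card B\<close> and drop out mod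
  2.\<close>

lemma odd_card_sym_diff:
  assumes "finite A" and "finite B"
  shows "odd (card (sym_diff A B)) \<longleftrightarrow> odd (card A) \<noteq> odd (card B)"
proof -
  have "card (sym_diff A B) = card (A - B) + card (B - A)"
    using assms by (intro card_Un_disjoint) auto
  moreover have "card A = card (A - B) + card (A \<inter> B)"
    using assms card_Int_Diff[of A B] by simp
  moreover have "card B = card (B - A) + card (A \<inter> B)"
    using assms card_Int_Diff[of B A] by (simp add: Int_commute)
  ultimately show ?thesis by presburger
qed

lemma odd_card_Int_sym_diff:
  assumes "finite A"
  shows "odd (card (A \<inter> sym_diff B C)) \<longleftrightarrow> odd (card (A \<inter> B)) \<noteq> odd (card (A \<inter> C))"
proof -
  have "A \<inter> sym_diff B C = sym_diff (A \<inter> B) (A \<inter> C)" by blast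
  then show ?thesis using odd_card_sym_diff[of "A \<inter> B" "A \<inter> C"] assms by simp
qed

section \<open>Knot diagrams as combinatorial maps\<close>

text \<open>The crossingless loop has no darts and is left to the final theorem.\<close>

locale knot_map =
  fixes H :: "'d set" and alpha sigma :: "'d \<Rightarrow> 'd"
  assumes knot: "knot_diagram H alpha sigma" and nonempty: "H \<noteq> {}"
begin

lemma fin [simp]: "finite H" and alpha_perm: "alpha permutes H" and sigma_perm: "sigma permutes H"
  using knot by (auto simp: knot_diagram_def)

sublocale al: finite_perm alpha H by unfold_locales (simp_all add: alpha_perm)
sublocale si: finite_perm sigma H by unfold_locales (simp_all add: sigma_perm)
sublocale ph: finite_perm "sigma \<circ> alpha" H
  by unfold_locales (simp_all add: alpha_perm sigma_perm permutes_compose)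
sublocale ta: finite_perm "(sigma ^^ 2) \<circ> alpha" H
  by unfold_locales (simp_all add: alpha_perm sigma_perm permutes_compose numeral_2_eq_2)

abbreviation face :: "'d \<Rightarrow> 'd set" where "face d \<equiv> orbit_of (sigma \<circ> alpha) d"
abbreviation vertex :: "'d \<Rightarrow> 'd set" where "vertex d \<equiv> orbit_of sigma d"

section \<open>Darts at a crossing and the straight-ahead walk\<close>

lemma alpha_alpha [simp]: "alpha (alpha d) = d"
  using knot alpha_perm by (cases "d \<in> H") (auto simp: knot_diagram_def permutes_def)

lemma alpha_neq: "d \<in> H \<Longrightarrow> alpha d \<noteq> d"
  using knot by (auto simp: knot_diagram_def)

lemma card_vertex: "d \<in> H \<Longrightarrow> card (vertex d) = 4"
  using knot by (auto simp: knot_diagram_def)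

lemma face_next [simp]: "face (sigma (alpha d)) = face d"
  using ph.orbit_of_image[of d] by simp

text \<open>By \<open>face_next\<close> at \<open>alpha d\<close>. A dart also names a corner of its
  crossing: the edge of \<open>d\<close> has \<open>face d\<close> and \<open>face (sigma d)\<close>
  on its two sides.\<close>

lemma face_alpha: "face (alpha d) = face (sigma d)"
  using face_next[of "alpha d"] by simp

text \<open>An earlier return to \<open>x\<close> would close the orbit with fewer than four darts.
  The fourth step stays in the orbit and by injectivity can only hit \<open>x\<close>.\<close>

lemma
  assumes x: "x \<in> H"
  shows sigma4: "sigma (sigma (sigma (sigma x))) = x"
    and vertex_eq: "vertex x = {x, sigma x, sigma (sigma x), sigma (sigma (sigma x))}"
    and sigma_neq: "sigma x \<noteq> x" "sigma (sigma x) \<noteq> x" "sigma (sigma (sigma x)) \<noteq> x"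
proof -
  have small: "\<not> vertex x \<subseteq> Y" if "finite Y" "card Y < 4" for Y
    using card_vertex[OF x] card_mono[OF that(1), of "vertex x"] that(2) by auto
  show 1: "sigma x \<noteq> x"
    using small[of "{x}"] orbit_of_least[of x "{x}" sigma] by auto
  show 2: "sigma (sigma x) \<noteq> x"
    using small[of "{x, sigma x}"] orbit_of_least[of x "{x, sigma x}" sigma] card_insert_le_m1
    by (auto simp: 1[symmetric])
  show 3: "sigma (sigma (sigma x)) \<noteq> x"
    using small[of "{x, sigma x, sigma (sigma x)}"]
      orbit_of_least[of x "{x, sigma x, sigma (sigma x)}" sigma]
    using 1 2 by auto
  let ?Y = "{x, sigma x, sigma (sigma x), sigma (sigma (sigma x))}"
  have in_orbit: "sigma y \<in> vertex x" if "y \<in> vertex x" for y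
    using that by (simp add: si.in_orbit_of_iff)
  have "?Y \<subseteq> vertex x" using in_orbit orbit_of_refl[of x sigma] by blast
  moreover have "finite (vertex x)" using card_vertex[OF x] card.infinite by fastforce
  moreover have "card ?Y = 4" using 1 2 3 by (auto simp: card_insert_if)
  ultimately show Y: "vertex x = ?Y" using card_vertex[OF x] by (metis card_subset_eq)
  have "sigma (sigma (sigma (sigma x))) \<in> vertex x" using in_orbit Y by blast
  then show "sigma (sigma (sigma (sigma x))) = x" using 1 2 3 unfolding Y by auto
qed

text \<open>\<open>alpha\<close> conjugates the straight-ahead step to its inverse, so a walk from
  \<open>d\<close> to \<open>alpha d\<close> can be shortened by one step at both ends until its
  length is 0 or 1, where \<open>alpha\<close> or \<open>sigma ^^ 2\<close> would fix a
  dart.\<close>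

lemma tau_pow_neq_alpha: "d \<in> H \<Longrightarrow> (((sigma ^^ 2) \<circ> alpha) ^^ n) d \<noteq> alpha d"
proof (induction n arbitrary: d rule: less_induct)
  case (less n)
  let ?t = "(sigma ^^ 2) \<circ> alpha"
  have t: "?t y = sigma (sigma (alpha y))" for y by (simp add: numeral_2_eq_2)
  consider "n = 0" | "n = 1" | m where "n = Suc (Suc m)" by (metis One_nat_def not0_implies_Suc)
  then show ?case
  proof cases
    case 1 then show ?thesis using alpha_neq[OF less.prems] by auto
  next
    case 2 then show ?thesis using sigma_neq(2)[of "alpha d"] less.prems by (simp add: numeral_2_eq_2)
  next
    case 3
    have inv: "?t (alpha (?t y)) = alpha y" if "y \<in> H" for y
      using sigma4[of "alpha y"] that by (simp add: numeral_2_eq_2)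
    show ?thesis
    proof
      assume "(?t ^^ n) d = alpha d"
      then have "?t ((?t ^^ m) (?t d)) = alpha d"
        unfolding 3 by (simp only: funpow.simps(2) funpow_swap1 o_apply)
      then have "?t ((?t ^^ m) (?t d)) = ?t (alpha (?t d))"
        using inv[OF less.prems] by (simp only:)
      then have "(?t ^^ m) (?t d) = alpha (?t d)" using ta.image_eq by blast
      moreover have "?t d \<in> H" using less.prems by (simp only: t) simp
      ultimately show False using less.IH[of m "?t d"] unfolding 3 by (meson less_SucI lessI)
    qed
  qed
qed

text \<open>The two orientations of the single component are exchanged by \<^term>\<open>alpha\<close>.\<close>

lemma single_component:
  assumes "X \<subseteq> H" "X \<noteq> {}" "\<And>d. d \<in> X \<Longrightarrow> alpha d \<in> X" "\<And>d. d \<in> X \<Longrightarrow> sigma (sigma (alpha d)) \<in> X"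
  shows "X = H"
proof -
  let ?t = "(sigma ^^ 2) \<circ> alpha"
  obtain d where d: "d \<in> X" "d \<in> H" using assms by blast
  have "alpha d \<notin> orbit_of ?t d"
    using tau_pow_neq_alpha[OF d(2)] by (fastforce simp: orbit_of_def)
  then have ne: "orbit_of ?t d \<noteq> orbit_of ?t (alpha d)" using orbit_of_refl[of "alpha d" ?t] by auto
  have orb: "orbit_of ?t y \<subseteq> X" if "y \<in> X" for y
    using that assms(4) by (intro orbit_of_least) (simp_all add: numeral_2_eq_2)
  have "card (orbits_on ?t H) = 2" using knot nonempty by (simp add: knot_diagram_def)
  moreover have "{orbit_of ?t d, orbit_of ?t (alpha d)} \<subseteq> orbits_on ?t H"
    using d by (auto simp: orbits_on_def)
  ultimately have "orbits_on ?t H = {orbit_of ?t d, orbit_of ?t (alpha d)}"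
    using ne by (metis card_2_iff card_subset_eq card.infinite zero_neq_numeral)
  moreover have "H \<subseteq> \<Union> (orbits_on ?t H)"
    using orbit_of_refl by (fastforce simp: orbits_on_def)
  ultimately have "H \<subseteq> orbit_of ?t d \<union> orbit_of ?t (alpha d)" by auto
  also have "\<dots> \<subseteq> X" using orb[OF d(1)] orb[OF assms(3)[OF d(1)]] by (rule Un_least)
  finally have "H \<subseteq> X" .
  then show ?thesis using assms(1) by blast
qed

text \<open>Closure under \<open>alpha\<close> and \<open>sigma\<close> implies closure under the
  straight-ahead step, so a diagram with a single component is connected.\<close>

lemma connected:
  assumes "X \<subseteq> H" "X \<noteq> {}" "\<And>d. d \<in> X \<Longrightarrow> alpha d \<in> X" "\<And>d. d \<in> X \<Longrightarrow> sigma d \<in> X"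
  shows "X = H"
  using assms by (intro single_component) auto

section \<open>Euler's formula and the number of regions\<close>

lemma euler: "card (vertices H sigma) + card (faces H alpha sigma) = card (edges H alpha) + 2"
  using knot nonempty by (simp add: knot_diagram_def)

lemma card_alpha_orbit: "d \<in> H \<Longrightarrow> card (orbit_of alpha d) = 2"
proof -
  assume d: "d \<in> H"
  have "orbit_of alpha d = {d, alpha d}"
  proof
    show "orbit_of alpha d \<subseteq> {d, alpha d}" by (rule orbit_of_least) auto
    show "{d, alpha d} \<subseteq> orbit_of alpha d"
      using orbit_of_refl[of d alpha] by (simp add: al.in_orbit_of_iff)
  qed
  then show ?thesis using alpha_neq[OF d] by auto
qed

text \<open>There are four darts per crossing and two per edge, hence twice as many edges as
  crossings; Euler's formula does the rest.\<close>

lemma card_faces: "card (faces H alpha sigma) = card (vertices H sigma) + 2"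
proof -
  have "H \<in> si.invariant_sets" "H \<in> al.invariant_sets"
    by (auto simp: si.invariant_sets_def al.invariant_sets_def)
  then have "card H = 4 * card (vertices H sigma)" "card H = 2 * card (edges H alpha)"
    using si.card_eq_orbits[of H 4] al.card_eq_orbits[of H 2] card_vertex card_alpha_orbit
    by (auto simp: vertices_def edges_def)
  then show ?thesis using euler by linarith
qed

section \<open>Planarity: cuts and separation\<close>

text \<open>In the dual map a set of crossings is a set of faces, and this is its mod 2 boundary,
  stored with both darts of each edge.\<close>

definition cut :: "'d set \<Rightarrow> 'd set" where
  "cut S = {d \<in> H. (d \<in> S) \<noteq> (alpha d \<in> S)}"

text \<open>For an edge set \<open>C\<close>, its mod 2 boundary in the dual map, whose vertices are
  the regions. An edge with the same region on both sides would contribute two darts there and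
  cancel.\<close>

definition bdry :: "'d set \<Rightarrow> 'd set" where
  "bdry C = {d \<in> H. odd (card (face d \<inter> C))}"

section \<open>Cuts and boundaries mod 2, and how many there are\<close>

lemma finite_invariant [simp]:
  "finite si.invariant_sets" "finite al.invariant_sets" "finite ph.invariant_sets"
  by (rule finite_subset[of _ "Pow H"];
      auto simp: si.invariant_sets_def al.invariant_sets_def ph.invariant_sets_def)+

lemma finite_face: "d \<in> H \<Longrightarrow> finite (face d)"
  using ph.orbit_of_subset finite_subset fin by blast

lemma bdry_sym_diff: "bdry (sym_diff B C) = sym_diff (bdry B) (bdry C)"
  unfolding bdry_def using odd_card_Int_sym_diff[OF finite_face] by auto

lemma sym_diff_alpha_invariant:
  "B \<in> al.invariant_sets \<Longrightarrow> C \<in> al.invariant_sets \<Longrightarrow> sym_diff B C \<in> al.invariant_sets"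
  by (auto simp: al.invariant_sets_def)

lemma bdry_image_sym_diff:
  assumes "X \<in> bdry ` al.invariant_sets" "Y \<in> bdry ` al.invariant_sets"
  shows "sym_diff X Y \<in> bdry ` al.invariant_sets"
proof -
  obtain B C where BC: "B \<in> al.invariant_sets" "C \<in> al.invariant_sets"
    and XY: "X = bdry B" "Y = bdry C"
    using assms by (elim imageE)
  have "sym_diff X Y = bdry (sym_diff B C)" by (simp only: bdry_sym_diff XY)
  then show ?thesis using sym_diff_alpha_invariant[OF BC] by (rule image_eqI)
qed

text \<open>Two crossing sets with the same cut differ by a set closed under \<open>alpha\<close>
  and \<open>sigma\<close>, which by connectedness is empty or all of \<open>H\<close>. So only
  \<open>S\<close> and its complement share a cut.\<close>

lemma card_cut_image: "card si.invariant_sets \<le> 2 * card (cut ` si.invariant_sets)"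
proof (rule card_le_fibres)
  fix Y assume "Y \<in> cut ` si.invariant_sets"
  then obtain S where S: "S \<in> si.invariant_sets" "Y = cut S" by blast
  have "{T \<in> si.invariant_sets. cut T = Y} \<subseteq> {S, H - S}"
  proof
    fix T assume "T \<in> {T \<in> si.invariant_sets. cut T = Y}"
    then have T: "T \<in> si.invariant_sets" "Y = cut T" by auto
    let ?D = "sym_diff S T"
    have DH: "?D \<subseteq> H" using S T by (auto simp: si.invariant_sets_def)
    have cuts: "((d \<in> S) \<noteq> (alpha d \<in> S)) \<longleftrightarrow> ((d \<in> T) \<noteq> (alpha d \<in> T))" if "d \<in> H" for d
      using S(2) T(2) that unfolding cut_def by blast
    have "?D = H" if "?D \<noteq> {}"
    proof (rule connected[OF DH that])
      show "alpha d \<in> ?D" if "d \<in> ?D" for d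
        using that cuts[of d] DH by blast
      show "sigma d \<in> ?D" if "d \<in> ?D" for d
        using that DH S(1) T(1) unfolding si.invariant_sets_def by blast
    qed
    then show "T \<in> {S, H - S}" using S(1) T(1) unfolding si.invariant_sets_def by blast
  qed
  then have "card {T \<in> si.invariant_sets. cut T = Y} \<le> card {S, H - S}"
    by (intro card_mono) auto
  then show "card {T \<in> si.invariant_sets. cut T = Y} \<le> 2"
    by (rule le_trans) (simp add: card_insert_if)
qed simp

lemma bdry_edge:
  assumes "d \<in> H"
  shows "bdry {d, alpha d} = sym_diff (face d) (face (alpha d))"
proof -
  have "odd (card (face y \<inter> {d, alpha d})) \<longleftrightarrow> (d \<in> face y) \<noteq> (alpha d \<in> face y)" for y
    using alpha_neq[OF assms] by (cases "d \<in> face y"; cases "alpha d \<in> face y") (auto simp: Int_insert_right)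
  then have "bdry {d, alpha d} = {y \<in> H. (d \<in> face y) \<noteq> (alpha d \<in> face y)}"
    by (simp add: bdry_def)
  also have "\<dots> = sym_diff (face d) (face (alpha d))"
    using ph.orbit_of_subset[of d] ph.orbit_of_subset[of "alpha d"] assms
    by (auto simp: ph.in_orbit_of_iff)
  finally show ?thesis .
qed

text \<open>Passing across an edge changes the region by the boundary of that edge, and
  connectedness links any two darts.\<close>

lemma face_diff_in_bdry_image:
  assumes "d \<in> H" "e \<in> H"
  shows "sym_diff (face d) (face e) \<in> bdry ` al.invariant_sets"
proof -
  let ?X = "{d \<in> H. sym_diff (face d) (face e) \<in> bdry ` al.invariant_sets}"
  have "bdry {} = {}" "{} \<in> al.invariant_sets" by (auto simp: bdry_def al.invariant_sets_def)
  then have empty: "{} \<in> bdry ` al.invariant_sets" by (metis image_eqI)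
  have step: "alpha d \<in> ?X" if "d \<in> ?X" for d
  proof -
    have "{d, alpha d} \<in> al.invariant_sets"
      by (rule al.closed_imp_invariant) (use that in auto)
    then have "sym_diff (face d) (face (alpha d)) \<in> bdry ` al.invariant_sets"
      using bdry_edge that by (metis (no_types, lifting) image_eqI mem_Collect_eq)
    then have "sym_diff (sym_diff (face d) (face (alpha d))) (sym_diff (face d) (face e))
        \<in> bdry ` al.invariant_sets"
      using bdry_image_sym_diff that by blast
    moreover have "sym_diff (sym_diff (face d) (face (alpha d))) (sym_diff (face d) (face e))
        = sym_diff (face (alpha d)) (face e)" by blast
    ultimately show ?thesis using that by auto
  qed
  have "?X = H"
  proof (rule connected)
    show "?X \<noteq> {}" using assms(2) empty by auto
    show "sigma d \<in> ?X" if "d \<in> ?X" for d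
      using step[OF that] that by (simp add: face_alpha)
  qed (use step in auto)
  then show ?thesis using assms(1) by blast
qed

text \<open>Modulo boundaries all regions agree, so every set of regions is congruent to the empty
  set or to the single region \<open>face e\<close>. Boundaries are therefore at least half of all
  sets of regions.\<close>

lemma card_bdry_image: "card ph.invariant_sets \<le> 2 * card (bdry ` al.invariant_sets)"
proof -
  let ?I = "bdry ` al.invariant_sets"
  obtain e where e: "e \<in> H" using nonempty by blast
  have claim: "X \<in> ?I \<or> sym_diff X (face e) \<in> ?I" if "X \<in> ph.invariant_sets" for X
    using that
  proof (induction "card X" arbitrary: X rule: less_induct)
    case less
    show ?case
    proof (cases "X = {}")
      case True
      have "bdry {} = {}" "{} \<in> al.invariant_sets" by (auto simp: bdry_def al.invariant_sets_def)
      then show ?thesis using True by (metis image_eqI)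
    next
      case False
      then obtain d where d: "d \<in> X" by blast
      have XH: "X \<subseteq> H" using less.prems by (simp add: ph.invariant_sets_def)
      have sub: "face d \<subseteq> X" using ph.orbit_in_invariant[OF less.prems d] .
      have "X - face d \<in> ph.invariant_sets"
        using less.prems ph.orbit_of_invariant[of d] XH d unfolding ph.invariant_sets_def by blast
      moreover have "card (X - face d) < card X"
        using d XH orbit_of_refl[of d "sigma \<circ> alpha"] finite_subset[OF XH fin]
        by (intro psubset_card_mono) auto
      ultimately consider "X - face d \<in> ?I" | "sym_diff (X - face d) (face e) \<in> ?I"
        using less.hyps by blast
      then show ?thesis
      proof cases
        case 1
        have "sym_diff (X - face d) (sym_diff (face d) (face e)) \<in> ?I"
          by (rule bdry_image_sym_diff[OF 1 face_diff_in_bdry_image]) (use d XH e in auto)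
        moreover have "sym_diff (X - face d) (sym_diff (face d) (face e)) = sym_diff X (face e)"
          using sub by blast
        ultimately show ?thesis by simp
      next
        case 2
        have "sym_diff (sym_diff (X - face d) (face e)) (sym_diff (face d) (face e)) \<in> ?I"
          by (rule bdry_image_sym_diff[OF 2 face_diff_in_bdry_image]) (use d XH e in auto)
        moreover have "sym_diff (sym_diff (X - face d) (face e)) (sym_diff (face d) (face e)) = X"
          using sub by blast
        ultimately show ?thesis by simp
      qed
    qed
  qed
  have "ph.invariant_sets \<subseteq> ?I \<union> (\<lambda>Y. sym_diff Y (face e)) ` ?I"
  proof
    fix X assume X: "X \<in> ph.invariant_sets"
    have "X = sym_diff (sym_diff X (face e)) (face e)" by blast
    then show "X \<in> ?I \<union> (\<lambda>Y. sym_diff Y (face e)) ` ?I" using claim[OF X] by blast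
  qed
  then have "card ph.invariant_sets \<le> card (?I \<union> (\<lambda>Y. sym_diff Y (face e)) ` ?I)"
    by (intro card_mono) auto
  also have "\<dots> \<le> card ?I + card ((\<lambda>Y. sym_diff Y (face e)) ` ?I)" by (rule card_Un_le)
  also have "\<dots> \<le> card ?I + card ?I" by (intro add_mono card_image_le) auto
  finally show ?thesis by simp
qed

text \<open>Around a region, \<open>sigma \<circ> alpha\<close> maps the darts with far end in
  \<open>S\<close> bijectively onto the darts in \<open>S\<close>. Both kinds are equally many, so
  their symmetric difference is even.\<close>

lemma cut_cycle:
  assumes S: "S \<in> si.invariant_sets"
  shows "cut S \<in> al.invariant_sets" and "bdry (cut S) = {}"
proof -
  show "cut S \<in> al.invariant_sets" by (auto simp: al.invariant_sets_def cut_def)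
  have "even (card (face d \<inter> cut S))" if d: "d \<in> H" for d
  proof -
    have FH: "face d \<subseteq> H" by (rule ph.orbit_of_subset[OF d])
    let ?B = "{y \<in> H. alpha y \<in> S}"
    have next_iff: "sigma (alpha y) \<in> S \<longleftrightarrow> alpha y \<in> S" if "y \<in> H" for y
      using S that by (auto simp: si.invariant_sets_def)
    have in_face: "sigma (alpha y) \<in> face d \<longleftrightarrow> y \<in> face d" for y
      by (simp add: ph.in_orbit_of_iff)
    have "(sigma \<circ> alpha) ` (face d \<inter> ?B) = face d \<inter> S"
    proof
      show "(sigma \<circ> alpha) ` (face d \<inter> ?B) \<subseteq> face d \<inter> S"
        using next_iff in_face by auto
      show "face d \<inter> S \<subseteq> (sigma \<circ> alpha) ` (face d \<inter> ?B)"
      proof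
        fix z assume z: "z \<in> face d \<inter> S"
        then obtain y where y: "z = (sigma \<circ> alpha) y"
          using permutes_surj[OF ph.perm] by blast
        then have "y \<in> face d" using z in_face by auto
        then show "z \<in> (sigma \<circ> alpha) ` (face d \<inter> ?B)"
          using y z FH next_iff by auto
      qed
    qed
    moreover have "card ((sigma \<circ> alpha) ` (face d \<inter> ?B)) = card (face d \<inter> ?B)"
      by (intro card_image) (auto simp: inj_on_def)
    ultimately have "card (face d \<inter> S) = card (face d \<inter> ?B)" by argo
    moreover have "face d \<inter> cut S = face d \<inter> sym_diff S ?B"
      using FH by (auto simp: cut_def)
    ultimately show ?thesis using odd_card_Int_sym_diff[OF finite_face[OF d], of S ?B] by simp
  qed
  then show "bdry (cut S) = {}" unfolding bdry_def by blast
qed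

text \<open>Exactness of the cellular cochain complex mod 2 of the dual map in the middle: the
  Euler characteristic leaves no room for a cycle that is not a cut.\<close>

lemma cycle_is_cut:
  assumes C: "C \<in> al.invariant_sets" and even: "\<And>d. d \<in> H \<Longrightarrow> even (card (face d \<inter> C))"
  obtains S where "S \<in> si.invariant_sets" "cut S = C"
proof -
  let ?K = "{C \<in> al.invariant_sets. bdry C = {}}"
  \<comment> \<open>Translation by one member of a fibre of \<open>bdry\<close> embeds the cycles
    into that fibre.\<close>
  have "card ?K * card (bdry ` al.invariant_sets) \<le> card al.invariant_sets"
  proof (rule card_ge_fibres)
    fix Y assume "Y \<in> bdry ` al.invariant_sets"
    then obtain C where C: "C \<in> al.invariant_sets" "Y = bdry C" by blast
    have "inj_on (sym_diff C) ?K" by (rule inj_onI) blast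
    moreover have "sym_diff C ` ?K \<subseteq> {X \<in> al.invariant_sets. bdry X = Y}"
    proof clarify
      fix X assume X: "X \<in> al.invariant_sets" "bdry X = {}"
      show "sym_diff C X \<in> al.invariant_sets \<and> bdry (sym_diff C X) = Y"
        using sym_diff_alpha_invariant[OF C(1) X(1)] unfolding bdry_sym_diff X(2) C(2) by simp
    qed
    ultimately show "card ?K \<le> card {X \<in> al.invariant_sets. bdry X = Y}"
      by (intro card_inj_on_le) auto
  qed simp
  then have "card ?K * (2 * card (bdry ` al.invariant_sets)) \<le> 2 * 2 ^ card (edges H alpha)"
    by (simp add: al.card_invariant_sets edges_def)
  moreover have "card ?K * 2 ^ card (faces H alpha sigma)
      \<le> card ?K * (2 * card (bdry ` al.invariant_sets))"
    using card_bdry_image by (simp add: ph.card_invariant_sets faces_def)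
  ultimately have "card ?K * 2 ^ card (faces H alpha sigma) \<le> 2 * 2 ^ card (edges H alpha)"
    by linarith
  \<comment> \<open>Euler's formula rewrites this exponent as crossings plus regions; cancelling the
    regions bounds the cycles by half the number of crossing sets, which is at most the number of
    cuts.\<close>
  then have "2 * card ?K * 2 ^ card (faces H alpha sigma) \<le> 2 ^ (card (edges H alpha) + 2)"
    by (simp add: mult_ac)
  also have "\<dots> = 2 ^ card (vertices H sigma) * 2 ^ card (faces H alpha sigma)"
    by (simp only: euler[symmetric] power_add)
  finally have "2 * card ?K \<le> 2 ^ card (vertices H sigma)" by simp
  also have "\<dots> \<le> 2 * card (cut ` si.invariant_sets)"
    using card_cut_image by (simp add: si.card_invariant_sets vertices_def)
  finally have "card ?K \<le> card (cut ` si.invariant_sets)" by simp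
  moreover have "cut ` si.invariant_sets \<subseteq> ?K" using cut_cycle by auto
  ultimately have "cut ` si.invariant_sets = ?K" by (intro card_seteq) auto
  moreover have "C \<in> ?K" using C even by (auto simp: bdry_def)
  ultimately have "C \<in> cut ` si.invariant_sets" by (simp only:)
  then show ?thesis using that by (metis imageE)
qed

text \<open>Complementary crossing sets have the same cut.\<close>

lemma cut_avoiding:
  assumes C: "C \<in> al.invariant_sets" and even: "\<And>d. d \<in> H \<Longrightarrow> even (card (face d \<inter> C))"
  obtains S where "S \<in> si.invariant_sets" "cut S = C" "x \<notin> S"
proof -
  obtain S where S: "S \<in> si.invariant_sets" "cut S = C" using cycle_is_cut[OF C even] by blast
  have "H - S \<in> si.invariant_sets" using S(1) unfolding si.invariant_sets_def by auto
  moreover have "cut (H - S) = C" using S(2) by (auto simp: cut_def)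
  ultimately show ?thesis using S that by (cases "x \<in> S") blast+
qed

text \<open>A bridge \<open>x\<close> would cut off a set of whole vertices together with the single dart \<open>x\<close>,
  an odd number of darts in total.\<close>

lemma face_alpha_neq:
  assumes x: "x \<in> H"
  shows "face (alpha x) \<noteq> face x"
proof
  assume eq: "face (alpha x) = face x"
  let ?C = "{x, alpha x}"
  have C: "?C \<in> al.invariant_sets" by (rule al.closed_imp_invariant) (use x in auto)
  have "even (card (face d \<inter> ?C))" for d
  proof -
    have "x \<in> face d \<longleftrightarrow> alpha x \<in> face d" using eq by (simp add: ph.in_orbit_of_iff)
    then show ?thesis using alpha_neq[OF x] by (cases "x \<in> face d") (auto simp: Int_insert_right)
  qed
  then obtain S where S: "S \<in> si.invariant_sets" "cut S = ?C" "x \<notin> S"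
    using cut_avoiding[OF C] by metis
  have SH: "S \<subseteq> H" using S(1) by (simp add: si.invariant_sets_def)
  have "x \<in> cut S" using S(2) by simp
  then have ax: "alpha x \<in> S" using S(3) by (simp add: cut_def)
  have "insert x S \<in> al.invariant_sets"
  proof (rule al.closed_imp_invariant)
    fix d assume d: "d \<in> insert x S"
    show "alpha d \<in> insert x S"
    proof (rule ccontr)
      assume "alpha d \<notin> insert x S"
      then have "d \<in> cut S" "d \<noteq> alpha x" "d \<noteq> x" using d ax SH by (auto simp: cut_def)
      then show False using S(2) by simp
    qed
  qed (use SH x in auto)
  then have "even (card (insert x S))"
    using al.card_eq_orbits[of "insert x S" 2] card_alpha_orbit SH x
    by (metis dvd_triv_left insert_subset subsetD)
  moreover have "card S = 4 * card (orbits_on sigma S)"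
    using card_vertex SH by (intro si.card_eq_orbits[OF S(1)]) auto
  ultimately show False using S(3) finite_subset[OF SH fin] by simp
qed

text \<open>Hence only opposite corners of a crossing can share a region.\<close>

corollary face_sigma_neq: "x \<in> H \<Longrightarrow> face (sigma x) \<noteq> face x"
  using face_alpha_neq face_alpha by metis

text \<open>\<open>U\<close> consists of the darts on the side of \<open>x\<close> and \<open>sigma x\<close> of a circle that meets the
  diagram only at the crossing \<open>vertex x\<close> and separates these two darts there from the other two.\<close>

definition separates :: "'d \<Rightarrow> 'd set \<Rightarrow> bool" where
  "separates x U \<longleftrightarrow> U \<in> al.invariant_sets \<and> x \<in> U \<and> sigma x \<in> U \<and>
     sigma (sigma x) \<notin> U \<and> sigma (sigma (sigma x)) \<notin> U \<and>
     (\<forall>d\<in>H. d \<notin> vertex x \<longrightarrow> (sigma d \<in> U \<longleftrightarrow> d \<in> U))"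

section \<open>The two sides of a reducible crossing\<close>

lemma separates_subset: "separates x U \<Longrightarrow> U \<subseteq> H"
  by (simp add: separates_def al.invariant_sets_def)

lemma separates_alpha: "separates x U \<Longrightarrow> d \<in> H \<Longrightarrow> alpha d \<in> U \<longleftrightarrow> d \<in> U"
  by (simp add: separates_def al.invariant_sets_def)

text \<open>The other side of the same circle: two turns of \<open>sigma\<close> exchange the two
  pairs of darts.\<close>

lemma separates_opposite:
  assumes "x \<in> H" "separates x U"
  shows "separates (sigma (sigma x)) (H - U)"
  using assms sigma4[OF assms(1)] unfolding separates_def al.invariant_sets_def by auto

text \<open>The edges of \<open>x\<close> and \<open>sigma x\<close> border the same two regions, so
  together they form a cycle of the dual map, and hence a cut.\<close>

lemma separating_set:
  assumes x: "x \<in> H" and same: "face (sigma (sigma x)) = face x"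
  obtains U where "separates x U"
proof -
  let ?y = "sigma x"
  have y: "?y \<in> H" using x by simp
  \<comment> \<open>The mod 2 sum of the two edges is empty when \<open>x\<close> and
    \<open>sigma x\<close> are the two ends of one loop.\<close>
  let ?C = "sym_diff {x, alpha x} {?y, alpha ?y}"
  have "{x, alpha x} \<in> al.invariant_sets" "{?y, alpha ?y} \<in> al.invariant_sets"
    by (rule al.closed_imp_invariant; use x in auto)+
  then have C: "?C \<in> al.invariant_sets" by (rule sym_diff_alpha_invariant)
  have "even (card (face d \<inter> ?C))" if d: "d \<in> H" for d
  proof -
    have odd_iff: "odd (card (face d \<inter> {z, alpha z})) \<longleftrightarrow> (z \<in> face d) \<noteq> (alpha z \<in> face d)"
      if "z \<in> H" for z
      using alpha_neq[OF that]
      by (cases "z \<in> face d"; cases "alpha z \<in> face d") (auto simp: Int_insert_right)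
    have "alpha x \<in> face d \<longleftrightarrow> ?y \<in> face d" "alpha ?y \<in> face d \<longleftrightarrow> x \<in> face d"
      by (simp_all add: ph.in_orbit_of_iff face_alpha same)
    then show ?thesis
      using odd_card_Int_sym_diff[OF finite_face[OF d], of "{x, alpha x}" "{?y, alpha ?y}"]
        odd_iff[OF x] odd_iff[OF y] by argo
  qed
  then obtain S where S: "S \<in> si.invariant_sets" "cut S = ?C" "x \<notin> S"
    using cut_avoiding[OF C] by metis
  have SH: "S \<subseteq> H" using S(1) by (simp add: si.invariant_sets_def)
  have sS: "sigma d \<in> S \<longleftrightarrow> d \<in> S" if "d \<in> H" for d
    using S(1) that by (simp add: si.invariant_sets_def)
  \<comment> \<open>\<open>S\<close> omits the whole crossing of \<open>x\<close>; the two added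
    darts are the ends at this crossing of the only edges that can leave \<open>S\<close>.\<close>
  let ?U = "insert x (insert ?y S)"
  have aU: "alpha z \<in> ?U" if "z \<in> {x, ?y}" for z
  proof (cases "alpha z \<in> {x, ?y}")
    case False
    then have "z \<in> ?C" using that sigma_neq(1)[OF x] by (auto dest: arg_cong[of _ _ alpha])
    then have "z \<in> cut S" using S(2) by simp
    then show ?thesis using that S(3) sS x by (auto simp: cut_def)
  qed auto
  have "?U \<in> al.invariant_sets"
  proof (rule al.closed_imp_invariant)
    fix d assume d: "d \<in> ?U"
    show "alpha d \<in> ?U"
    proof (cases "d \<in> {x, ?y}")
      case False
      show ?thesis
      proof (rule ccontr)
        assume na: "alpha d \<notin> ?U"
        then have "d \<in> cut S" using False d SH by (auto simp: cut_def)
        then have "d \<in> ?C" using S(2) by simp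
        then have "alpha d \<in> {x, ?y}" using False by auto
        then show False using na by auto
      qed
    qed (use aU in auto)
  qed (use SH x in auto)
  moreover have "sigma d \<in> ?U \<longleftrightarrow> d \<in> ?U" if "d \<in> H" "d \<notin> vertex x" for d
    using that vertex_eq[OF x] sS[OF that(1)] sigma4[OF x] si.image_eq
    by (metis insert_iff)
  ultimately have "separates x ?U"
    using S(3) sS x sigma_neq[OF x] sigma_neq[OF y] by (auto simp: separates_def)
  then show ?thesis by (rule that)
qed

lemma separates_vertex:
  assumes "separates x U" "d \<in> H" "d \<notin> vertex x" "e \<in> vertex d"
  shows "e \<in> U \<longleftrightarrow> d \<in> U"
proof -
  have "vertex d \<subseteq> {e \<in> H. e \<in> U \<longleftrightarrow> d \<in> U}"
  proof (rule orbit_of_least)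
    fix e assume e: "e \<in> {e \<in> H. e \<in> U \<longleftrightarrow> d \<in> U}" "e \<in> vertex d"
    then have "e \<notin> vertex x" using assms(3) by (simp add: si.in_orbit_of_iff)
    then show "sigma e \<in> {e \<in> H. e \<in> U \<longleftrightarrow> d \<in> U}" using e assms(1) by (auto simp: separates_def)
  qed (use assms in auto)
  then show ?thesis using assms(4) by blast
qed

text \<open>Along a region, \<open>alpha\<close> keeps the side, and \<open>sigma\<close> changes it
  only from \<open>sigma x\<close> to \<open>sigma (sigma x)\<close> or from
  \<open>sigma (sigma (sigma x))\<close> to \<open>x\<close>. Both steps lead into
  \<open>face x\<close>, which is excluded here.\<close>

lemma separates_face:
  assumes x: "x \<in> H" "face (sigma (sigma x)) = face x" and sep: "separates x U"
    and d: "d \<in> H" "face d \<noteq> face x"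
  shows "face d \<subseteq> U \<longleftrightarrow> d \<in> U"
proof -
  have "face d \<subseteq> {e \<in> H. e \<in> U \<longleftrightarrow> d \<in> U}"
  proof (rule orbit_of_least)
    fix e assume e: "e \<in> {e \<in> H. e \<in> U \<longleftrightarrow> d \<in> U}" "e \<in> face d"
    let ?z = "alpha e"
    have ne: "face (sigma ?z) \<noteq> face x" using e(2) d(2) by (simp add: ph.in_orbit_of_iff)
    have "sigma ?z \<in> U \<longleftrightarrow> ?z \<in> U"
    proof (cases "?z \<in> vertex x")
      case True
      have "?z \<noteq> sigma x" "?z \<noteq> sigma (sigma (sigma x))"
        using ne x(2) sigma4[OF x(1)] by metis+
      then have "?z = x \<or> ?z = sigma (sigma x)" using True vertex_eq[OF x(1)] by simp
      then show ?thesis using sep by (auto simp: separates_def)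
    qed (use sep e in \<open>auto simp: separates_def\<close>)
    then show "(sigma \<circ> alpha) e \<in> {e \<in> H. e \<in> U \<longleftrightarrow> d \<in> U}"
      using e(1) separates_alpha[OF sep, of e] by auto
  qed (use d in auto)
  then show ?thesis using orbit_of_refl[of d "sigma \<circ> alpha"] by blast
qed

text \<open>Neighbouring corners differ because there are no bridges; the two side regions differ
  because they lie on opposite sides of the separating circle.\<close>

lemma side_faces_neq:
  assumes x: "x \<in> H" "face (sigma (sigma x)) = face x"
  shows "face (sigma x) \<noteq> face x" "face (sigma (sigma (sigma x))) \<noteq> face x"
    "face (sigma x) \<noteq> face (sigma (sigma (sigma x)))"
proof -
  show 1: "face (sigma x) \<noteq> face x" using face_sigma_neq x by blast
  show 3: "face (sigma (sigma (sigma x))) \<noteq> face x"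
    using face_sigma_neq[of "sigma (sigma x)"] x by simp
  obtain U where U: "separates x U" using separating_set[OF x] .
  have "face (sigma x) \<subseteq> U" "\<not> face (sigma (sigma (sigma x))) \<subseteq> U"
    using separates_face[OF x U _ 1] separates_face[OF x U _ 3] U x by (auto simp: separates_def)
  then show "face (sigma x) \<noteq> face (sigma (sigma (sigma x)))" by metis
qed

end

section \<open>Null patterns\<close>

lemma sum_dvd_cong:
  fixes c p q :: "'b \<Rightarrow> int"
  assumes "\<And>f. f \<in> A \<Longrightarrow> m dvd p f - q f"
  shows "m dvd (\<Sum>f\<in>A. c f * p f) \<longleftrightarrow> m dvd (\<Sum>f\<in>A. c f * q f)"
proof -
  have "m dvd (\<Sum>f\<in>A. c f * (p f - q f))"
    using assms by (intro dvd_sum dvd_mult)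
  then have "m dvd (\<Sum>f\<in>A. c f * p f) - (\<Sum>f\<in>A. c f * q f)"
    by (simp add: right_diff_distrib sum_subtractf)
  then show ?thesis by (metis diff_add_cancel dvd_add_right_iff dvd_diff_commute)
qed

locale knot_game = knot_map +
  fixes k :: nat
  assumes k: "2 \<le> k"
begin

text \<open>Residues modulo \<open>k\<close> are represented by integers and compared by
  divisibility. A touching region enters once, even with two corners at \<open>v\<close>.\<close>

definition row :: "('a set \<Rightarrow> 'a set \<Rightarrow> int) \<Rightarrow> 'a set \<Rightarrow> ('a set \<Rightarrow> int) \<Rightarrow> int" where
  "row c v p = (\<Sum>f\<in>face ` v. c v f * p f)"

definition null :: "('a set \<Rightarrow> 'a set \<Rightarrow> int) \<Rightarrow> ('a set \<Rightarrow> int) \<Rightarrow> bool" where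
  "null c p \<longleftrightarrow> (\<forall>v\<in>vertices H sigma. int k dvd row c v p)"

text \<open>Counting with multiplicity makes the row a sum over the four corners; at an irreducible
  crossing every touching region gets weight 1.\<close>

definition corner_weight :: "'a set \<Rightarrow> 'a set \<Rightarrow> int" where
  "corner_weight v f = int (card (v \<inter> f))"

abbreviation faceset :: "'a set set" where "faceset \<equiv> faces H alpha sigma"

definition kernel :: "('a set \<Rightarrow> 'a set \<Rightarrow> int) \<Rightarrow> ('a set \<Rightarrow> int) set" where
  "kernel c = {p \<in> faceset \<rightarrow>\<^sub>E {0..<int k}. null c p}"

section \<open>Rows of the game matrix modulo \<open>k\<close>\<close>

lemma finite_faces [simp]: "finite faceset" and finite_vertices [simp]: "finite (vertices H sigma)"
  by (simp_all add: faces_def vertices_def orbits_on_def)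

lemma face_in [simp]: "d \<in> H \<Longrightarrow> face d \<in> faceset"
  by (simp add: faces_def orbits_on_def)

lemma vertex_in [simp]: "d \<in> H \<Longrightarrow> vertex d \<in> vertices H sigma"
  by (simp add: vertices_def orbits_on_def)

lemma vertexE:
  assumes "v \<in> vertices H sigma"
  obtains x where "x \<in> H" "v = vertex x"
  using assms by (auto simp: vertices_def orbits_on_def)

lemma faceE:
  assumes "f \<in> faceset"
  obtains x where "x \<in> H" "f = face x"
  using assms by (auto simp: faces_def orbits_on_def)

lemma vertex_subset: "v \<in> vertices H sigma \<Longrightarrow> v \<subseteq> H"
  by (elim vertexE) (use si.orbit_of_subset in blast)

lemma row_cong:
  assumes "\<And>d. d \<in> v \<Longrightarrow> int k dvd p (face d) - q (face d)"
  shows "int k dvd row c v p \<longleftrightarrow> int k dvd row c v q"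
  unfolding row_def using assms by (intro sum_dvd_cong) auto

lemma null_cong:
  assumes "\<And>f. f \<in> faceset \<Longrightarrow> int k dvd p f - q f"
  shows "null c p \<longleftrightarrow> null c q"
proof -
  have "int k dvd row c v p \<longleftrightarrow> int k dvd row c v q" if "v \<in> vertices H sigma" for v
    using vertex_subset[OF that] assms by (intro row_cong) auto
  then show ?thesis by (simp add: null_def)
qed

lemma row_diff: "row c v (\<lambda>f. p f - q f) = row c v p - row c v q"
  by (simp add: row_def right_diff_distrib sum_subtractf)

lemma row_corner_weight:
  assumes "x \<in> H" "c (vertex x) = corner_weight (vertex x)"
  shows "row c (vertex x) p = p (face x) + p (face (sigma x)) + p (face (sigma (sigma x)))
    + p (face (sigma (sigma (sigma x))))"
proof -
  let ?v = "vertex x"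
  have fin: "finite ?v" using vertex_eq[OF assms(1)] by simp
  have "(\<Sum>d\<in>?v. p (face d)) = (\<Sum>f\<in>face ` ?v. \<Sum>d | d \<in> ?v \<and> face d = f. p (face d))"
    by (rule sum.image_gen[OF fin])
  also have "\<dots> = (\<Sum>f\<in>face ` ?v. int (card (?v \<inter> f)) * p f)"
  proof (rule sum.cong[OF refl])
    fix f assume "f \<in> face ` ?v"
    then obtain y where "f = face y" by blast
    then have "d \<in> f \<longleftrightarrow> face d = f" for d by (simp only: ph.in_orbit_of_iff)
    then have "{d \<in> ?v. face d = f} = ?v \<inter> f" by blast
    moreover have "(\<Sum>d | d \<in> ?v \<and> face d = f. p (face d)) = (\<Sum>d | d \<in> ?v \<and> face d = f. p f)"
      by (rule sum.cong) auto
    ultimately show "(\<Sum>d | d \<in> ?v \<and> face d = f. p (face d)) = int (card (?v \<inter> f)) * p f"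
      by simp
  qed
  also have "\<dots> = row c ?v p" by (simp add: row_def assms(2) corner_weight_def)
  finally have "row c ?v p = (\<Sum>d\<in>?v. p (face d))" by simp
  also have "\<dots> = (\<Sum>d\<in>{x, sigma x, sigma (sigma x), sigma (sigma (sigma x))}. p (face d))"
    by (simp only: vertex_eq[OF assms(1)])
  also have "\<dots> = p (face x) + p (face (sigma x)) + p (face (sigma (sigma x)))
    + p (face (sigma (sigma (sigma x))))"
    using sigma_neq[OF assms(1)] by (simp add: eq_commute[of x])
  finally show ?thesis .
qed

text \<open>Pigeonhole: there are two more regions than crossings.\<close>

lemma card_kernel_ge: "k ^ 2 \<le> card (kernel c)"
proof -
  let ?V = "vertices H sigma"
  let ?A = "faceset \<rightarrow>\<^sub>E {0..<int k}"
  let ?h = "\<lambda>p. \<lambda>v\<in>?V. row c v p mod int k"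
  have finA: "finite ?A" by (intro finite_PiE) auto
  have "card ?A \<le> card (kernel c) * card (?h ` ?A)"
  proof (rule card_le_fibres[OF finA])
    fix Y assume "Y \<in> ?h ` ?A"
    then obtain q where q: "q \<in> ?A" "Y = ?h q" by blast
    \<comment> \<open>Subtracting a fixed member \<open>q\<close> of a fibre of the row map embeds
      that fibre into the kernel.\<close>
    let ?g = "\<lambda>p. \<lambda>f\<in>faceset. (p f - q f) mod int k"
    have "?g p \<in> kernel c" if p: "p \<in> ?A" "?h p = Y" for p
    proof -
      have "int k dvd row c v (\<lambda>f. p f - q f)" if "v \<in> ?V" for v
      proof -
        have "?h p v = ?h q v" using p q by simp
        then show ?thesis using that by (simp add: row_diff mod_eq_dvd_iff)
      qed
      then have "null c (\<lambda>f. p f - q f)" by (simp add: null_def)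
      moreover have "null c (?g p) \<longleftrightarrow> null c (\<lambda>f. p f - q f)"
        by (rule null_cong) (simp add: mod_eq_dvd_iff[symmetric])
      ultimately show ?thesis using k by (simp add: kernel_def)
    qed
    moreover have "inj_on ?g ?A"
    proof (rule inj_onI)
      fix p p' assume p: "p \<in> ?A" "p' \<in> ?A" and eq: "?g p = ?g p'"
      show "p = p'"
      proof (rule PiE_ext[OF p])
        fix f assume f: "f \<in> faceset"
        have "?g p f = ?g p' f" using eq by simp
        then have "(p f - q f) mod int k = (p' f - q f) mod int k" using f by simp
        then have "int k dvd p f - p' f" by (simp add: mod_eq_dvd_iff)
        then have "p f mod int k = p' f mod int k" by (simp add: mod_eq_dvd_iff)
        moreover have "p f \<in> {0..<int k}" "p' f \<in> {0..<int k}" using p f by (auto dest: PiE_mem)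
        ultimately show "p f = p' f" by simp
      qed
    qed
    then have "inj_on ?g {p \<in> ?A. ?h p = Y}" by (rule inj_on_subset) auto
    moreover have "finite (kernel c)" using finA by (simp add: kernel_def)
    ultimately show "card {p \<in> ?A. ?h p = Y} \<le> card (kernel c)"
      by (intro card_inj_on_le[of ?g]) auto
  qed
  also have "\<dots> \<le> card (kernel c) * card (?V \<rightarrow>\<^sub>E {0..<int k})"
  proof (intro mult_le_mono2 card_mono finite_PiE)
    show "?h ` ?A \<subseteq> ?V \<rightarrow>\<^sub>E {0..<int k}" using k by (auto intro!: restrict_PiE_iff[THEN iffD2])
  qed auto
  finally have "k ^ card faceset \<le> card (kernel c) * k ^ card ?V"
    by (simp add: card_PiE)
  then have "k ^ 2 * k ^ card ?V \<le> card (kernel c) * k ^ card ?V"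
    by (simp only: card_faces power_add mult.commute)
  moreover have "0 < k ^ card ?V" using k by simp
  ultimately show ?thesis by (metis mult_le_cancel2)
qed

text \<open>Applied to differences, this says that null patterns are determined by their values
  beside one edge. All edges are included because the normalization of a crossing passes from one
  edge to another.\<close>

definition rigid :: "('a set \<Rightarrow> 'a set \<Rightarrow> int) \<Rightarrow> bool" where
  "rigid c \<longleftrightarrow> (\<forall>e\<in>H. \<forall>p. null c p \<longrightarrow> int k dvd p (face e) \<longrightarrow> int k dvd p (face (alpha e)) \<longrightarrow>
     (\<forall>f\<in>faceset. int k dvd p f))"

lemma rigidD:
  assumes "rigid c" "e \<in> H" "null c p" "int k dvd p (face e)" "int k dvd p (face (alpha e))" "d \<in> H"
  shows "int k dvd p (face d)"
  using assms face_in unfolding rigid_def by blast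

text \<open>Rigidity of the difference of two null patterns gives injectivity. The kernel is at
  least as large as the target, so the map is also onto.\<close>

lemma rigid_bij:
  assumes "rigid c" "e \<in> H"
  shows "bij_betw (\<lambda>p. (p (face e), p (face (alpha e)))) (kernel c) ({0..<int k} \<times> {0..<int k})"
proof -
  let ?g = "\<lambda>p. (p (face e), p (face (alpha e)))"
  let ?B = "{0..<int k} \<times> {0..<int k}"
  have inj: "inj_on ?g (kernel c)"
  proof (rule inj_onI)
    fix p q assume p: "p \<in> kernel c" and q: "q \<in> kernel c" and eq: "?g p = ?g q"
    have "null c (\<lambda>f. p f - q f)"
      using p q by (auto simp: kernel_def null_def row_diff intro: dvd_diff)
    then have dvd: "int k dvd p f - q f" if "f \<in> faceset" for f
      using assms(1)[unfolded rigid_def, rule_format, OF assms(2), of "\<lambda>f. p f - q f" f] eq that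
      by simp
    have "p \<in> faceset \<rightarrow>\<^sub>E {0..<int k}" "q \<in> faceset \<rightarrow>\<^sub>E {0..<int k}"
      using p q by (auto simp: kernel_def)
    then show "p = q"
    proof (rule PiE_ext)
      fix f assume f: "f \<in> faceset"
      have "p f mod int k = q f mod int k" using dvd[OF f] by (simp add: mod_eq_dvd_iff)
      moreover have "p f \<in> {0..<int k}" "q f \<in> {0..<int k}"
        using p q f by (auto simp: kernel_def dest: PiE_mem)
      ultimately show "p f = q f" by simp
    qed
  qed
  have sub: "?g ` kernel c \<subseteq> ?B"
    using assms(2) by (fastforce simp: kernel_def dest: PiE_mem)
  moreover have "card ?B \<le> card (?g ` kernel c)"
    using card_kernel_ge[of c] by (simp add: card_image[OF inj] power2_eq_square)
  ultimately have "?g ` kernel c = ?B" by (intro card_seteq) auto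
  then show ?thesis using inj by (simp add: bij_betw_def)
qed

corollary rigid_card: "rigid c \<Longrightarrow> card (kernel c) = k ^ 2"
  using rigid_bij nonempty bij_betw_same_card by (fastforce simp: power2_eq_square)

corollary rigid_prescribe:
  assumes "rigid c" "e \<in> H"
  obtains p where "null c p" "int k dvd p (face e) - s" "int k dvd p (face (alpha e)) - t"
proof -
  have "(s mod int k, t mod int k) \<in> (\<lambda>p. (p (face e), p (face (alpha e)))) ` kernel c"
    using rigid_bij[OF assms] k by (simp add: bij_betw_def)
  then obtain p where "p \<in> kernel c" "p (face e) = s mod int k" "p (face (alpha e)) = t mod int k"
    by auto
  then show ?thesis using that[of p] by (simp add: kernel_def mod_eq_dvd_iff[symmetric])
qed

text \<open>The sum of the pushes on the two sides of an edge changes sign at each crossing passed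
  along the knot, since it is completed there to the row of that crossing.\<close>

lemma rigid_corner_weight:
  assumes c: "\<And>v. v \<in> vertices H sigma \<Longrightarrow> c v = corner_weight v"
  shows "rigid c"
  unfolding rigid_def
proof (intro ballI allI impI)
  fix e p f
  assume e: "e \<in> H" and p: "null c p" and zero: "int k dvd p (face e)" "int k dvd p (face (alpha e))"
    and f: "f \<in> faceset"
  let ?K = "\<lambda>d. p (face d) + p (face (alpha d))"
  have "{d \<in> H. int k dvd ?K d} = H"
  proof (rule single_component)
    show "{d \<in> H. int k dvd ?K d} \<noteq> {}" using e zero by auto
    show "sigma (sigma (alpha d)) \<in> {d \<in> H. int k dvd ?K d}" if "d \<in> {d \<in> H. int k dvd ?K d}" for d
    proof -
      let ?x = "alpha d"
      have "int k dvd row c (vertex ?x) p" using p that by (simp add: null_def)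
      \<comment> \<open>The four corners pair up: two lie beside the edge of arrival, two beside the
        opposite edge.\<close>
      then have "int k dvd ?K d + ?K (sigma (sigma ?x))"
        using row_corner_weight[of ?x c p] c[of "vertex ?x"] that by (simp add: face_alpha add_ac)
      then have "int k dvd ?K (sigma (sigma ?x))" using that dvd_add_right_iff by blast
      then show ?thesis using that by simp
    qed
  qed (auto simp: add.commute)
  then have K: "int k dvd ?K d" if "d \<in> H" for d using that by blast
  have step: "int k dvd p (face (alpha d))" if "d \<in> H" "int k dvd p (face d)" for d
    using K[OF that(1)] that(2) dvd_add_right_iff by blast
  \<comment> \<open>Zero sums carry vanishing from one side of an edge to the other, hence through
    the connected diagram.\<close>
  have "{d \<in> H. int k dvd p (face d)} = H"
  proof (rule connected)
    show "{d \<in> H. int k dvd p (face d)} \<noteq> {}" using e zero by auto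
  qed (use step in \<open>auto simp flip: face_alpha\<close>)
  then show "int k dvd p f" using f by (auto elim: faceE)
qed

section \<open>Admissible weights and the normalization of reducible crossings\<close>

definition nonzerodiv :: "int \<Rightarrow> bool" where
  "nonzerodiv t \<longleftrightarrow> (\<forall>b. int k dvd t * b \<longrightarrow> int k dvd b)"

text \<open>Only crossings with nonstandard weights are constrained, so the condition survives
  normalizing one of them. The region with two corners may carry any weight.\<close>

definition admissible :: "('a set \<Rightarrow> 'a set \<Rightarrow> int) \<Rightarrow> bool" where
  "admissible c \<longleftrightarrow> (\<forall>v\<in>vertices H sigma. c v \<noteq> corner_weight v \<longrightarrow>
     (\<exists>x\<in>H. v = vertex x \<and> face (sigma (sigma x)) = face x \<and>
        nonzerodiv (c v (face (sigma x))) \<and> nonzerodiv (c v (face (sigma (sigma (sigma x)))))))"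

lemma row_reducible:
  assumes x: "x \<in> H" "face (sigma (sigma x)) = face x"
  shows "row c (vertex x) p = c (vertex x) (face x) * p (face x)
    + c (vertex x) (face (sigma x)) * p (face (sigma x))
    + c (vertex x) (face (sigma (sigma (sigma x)))) * p (face (sigma (sigma (sigma x))))"
proof -
  have "face ` vertex x = {face x, face (sigma x), face (sigma (sigma (sigma x)))}"
    using x(2) by (simp add: vertex_eq[OF x(1)] insert_commute)
  then show ?thesis using side_faces_neq[OF x] by (simp add: row_def eq_commute)
qed

text \<open>At a reducible crossing with arbitrary weights, null patterns are transferred to the
  weights \<^const>\<open>corner_weight\<close> by keeping them on one side of the crossing and replacing them
  on the other side.\<close>

lemma rigid_replace:
  assumes x: "x \<in> H" "face (sigma (sigma x)) = face x"
    and nzd: "nonzerodiv (c (vertex x) (face (sigma (sigma (sigma x)))))"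
    and std: "rigid (c(vertex x := corner_weight (vertex x)))"
    and U: "separates x U"
    and e: "e \<in> U" and p: "null c p" "int k dvd p (face e)" "int k dvd p (face (alpha e))"
    and d: "d \<in> H"
  shows "int k dvd p (face d)"
proof -
  let ?v = "vertex x" and ?w = "sigma (sigma (sigma x))"
  let ?c = "c(?v := corner_weight ?v)"
  have UH: "U \<subseteq> H" by (rule separates_subset[OF U])
  have w: "?w \<in> H" "face (alpha ?w) = face x"
    using x sigma4[OF x(1)] by (auto simp: face_alpha)
  have row_other: "row ?c v q = row c v q" if "v \<noteq> ?v" for v q using that by (simp add: row_def)
  have row_v: "row ?c ?v q = 2 * q (face x) + q (face (sigma x)) + q (face ?w)" for q
    using row_corner_weight[of x ?c q] x by simp
  have sides: "face (sigma x) \<subseteq> U" "\<not> face ?w \<subseteq> U"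
    using separates_face[OF x U _ side_faces_neq(1)[OF x]]
      separates_face[OF x U _ side_faces_neq(2)[OF x]] U x(1) by (auto simp: separates_def)
  \<comment> \<open>Agreement with \<open>p\<close> on the shared region \<open>face x\<close>
    allows gluing; the value on \<open>face ?w\<close> is chosen to make the standard row of the
    crossing vanish for the glued pattern.\<close>
  obtain z where z: "null ?c z" "int k dvd z (face ?w) - (- 2 * p (face x) - p (face (sigma x)))"
      "int k dvd z (face (alpha ?w)) - p (face x)"
    using rigid_prescribe[OF std w(1)] .
  define q where "q f = (if f = face x \<or> f \<subseteq> U then p f else z f)" for f
  have q_in: "q (face y) = p (face y)" if "y \<in> U" for y
    using separates_face[OF x U, of y] UH that by (auto simp: q_def)
  have q_out: "int k dvd q (face y) - z (face y)" if "y \<in> H" "y \<notin> U" for y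
    using separates_face[OF x U, of y] that z(3) w(2)
    by (cases "face y = face x") (auto simp: q_def dvd_diff_commute)
  have "int k dvd row ?c v q" if v: "v \<in> vertices H sigma" for v
  proof (cases "v = ?v")
    case True
    have "q (face x) = p (face x)" "q (face (sigma x)) = p (face (sigma x))" "q (face ?w) = z (face ?w)"
      using sides side_faces_neq[OF x] by (auto simp: q_def)
    then show ?thesis using z(2) True by (simp add: row_v algebra_simps)
  next
    case False
    obtain y where y: "y \<in> H" "v = vertex y" using v by (rule vertexE)
    then have ynx: "y \<notin> vertex x" using False by (auto simp: si.in_orbit_of_iff)
    note side = separates_vertex[OF U y(1) ynx]
    show ?thesis
    proof (cases "y \<in> U")
      case True
      have "int k dvd row ?c v q \<longleftrightarrow> int k dvd row ?c v p"
        using side True y(2) q_in by (intro row_cong) auto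
      then show ?thesis using p(1) v row_other[OF False] by (simp add: null_def)
    next
      case notU: False
      have "int k dvd row ?c v q \<longleftrightarrow> int k dvd row ?c v z"
        using side notU y(2) q_out vertex_subset[OF v] by (intro row_cong) auto
      then show ?thesis using z(1) v by (simp add: null_def)
    qed
  qed
  then have "null ?c q" by (simp add: null_def)
  moreover have "int k dvd q (face e)" "int k dvd q (face (alpha e))"
    using q_in[of e] q_in[of "alpha e"] e separates_alpha[OF U, of e] UH p by auto
  \<comment> \<open>Rigidity for the standard weights annihilates the glued pattern, and with it
    \<open>p\<close> on \<open>face x\<close> and \<open>face (sigma x)\<close>.\<close>
  ultimately have q0: "int k dvd q (face y)" if "y \<in> H" for y
    using rigidD[OF std, of e q y] e UH that by blast
  have p0: "int k dvd p (face x)" "int k dvd p (face (sigma x))"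
    using q0[of x] q0[of "sigma x"] q_in[of x] q_in[of "sigma x"] x U by (auto simp: separates_def)
  have "int k dvd row c ?v p" using p(1) x(1) by (simp add: null_def)
  \<comment> \<open>In the original row of \<open>p\<close> only the region \<open>face ?w\<close>
    is left, and its weight cancels.\<close>
  then have "int k dvd c ?v (face ?w) * p (face ?w)"
    unfolding row_reducible[OF x] using p0 by (metis dvd_add dvd_add_right_iff dvd_mult)
  then have pw: "int k dvd p (face ?w)" using nzd unfolding nonzerodiv_def by blast
  \<comment> \<open>Since \<open>p\<close> vanishes on all three regions at the crossing, it is null
    for the standard weights too, and rigidity applies at the edge of \<open>?w\<close>.\<close>
  have "int k dvd row ?c v p" if "v \<in> vertices H sigma" for v
  proof (cases "v = ?v")
    case True
    then show ?thesis using p0 pw by (simp add: row_v)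
  next
    case False
    then show ?thesis using p(1) that by (simp add: row_other null_def)
  qed
  then have "null ?c p" by (simp add: null_def)
  then show ?thesis using rigidD[OF std w(1), of p d] pw p0 w d by simp
qed

text \<open>Induction on the number of crossings with nonstandard weights: one of them is
  normalized, and the given edge lies on one of its two sides.\<close>

lemma rigid_admissible: "admissible c \<Longrightarrow> rigid c"
proof (induction "card {v \<in> vertices H sigma. c v \<noteq> corner_weight v}" arbitrary: c rule: less_induct)
  case less
  show ?case
  proof (cases "\<exists>v \<in> vertices H sigma. c v \<noteq> corner_weight v")
    case False
    then show ?thesis by (intro rigid_corner_weight) auto
  next
    case True
    then obtain v where v: "v \<in> vertices H sigma" "c v \<noteq> corner_weight v" by blast
    then obtain x where x: "x \<in> H" "v = vertex x" "face (sigma (sigma x)) = face x"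
      and nzd: "nonzerodiv (c v (face (sigma x)))" "nonzerodiv (c v (face (sigma (sigma (sigma x)))))"
      using less.prems by (auto simp: admissible_def)
    let ?c = "c(v := corner_weight v)"
    have "card {u \<in> vertices H sigma. ?c u \<noteq> corner_weight u} < card {v \<in> vertices H sigma. c v \<noteq> corner_weight v}"
      using v by (intro psubset_card_mono) auto
    moreover have "admissible ?c" using less.prems by (auto simp: admissible_def)
    ultimately have std: "rigid ?c" using less.hyps by blast
    obtain U where U: "separates x U" using separating_set x by blast
    \<comment> \<open>Seen from the other side of the circle, \<open>?y\<close> takes the role of
      \<open>x\<close> and the two side regions change places.\<close>
    let ?y = "sigma (sigma x)"
    have y: "?y \<in> H" "face (sigma (sigma ?y)) = face ?y" "vertex ?y = v" "sigma (sigma (sigma ?y)) = sigma x"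
      using x sigma4[OF x(1)] by simp_all
    show ?thesis unfolding rigid_def
    proof (intro ballI allI impI)
      fix e p f
      assume e: "e \<in> H" and p: "null c p" "int k dvd p (face e)" "int k dvd p (face (alpha e))"
        and "f \<in> faceset"
      then obtain d where d: "d \<in> H" "f = face d" by (elim faceE)
      show "int k dvd p f"
      proof (cases "e \<in> U")
        case True
        show ?thesis unfolding d(2)
          by (rule rigid_replace[OF x(1,3) _ _ U True p d(1)]) (use nzd(2) std x(2) in simp_all)
      next
        case False
        then have eU: "e \<in> H - U" using e by simp
        show ?thesis unfolding d(2)
          by (rule rigid_replace[OF y(1,2) _ _ separates_opposite[OF x(1) U] eU p d(1)])
            (use nzd(1) std y(3,4) in simp_all)
      qed
    qed
  qed
qed

section \<open>Versions of the game\<close>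

lemma regions_eq: "regions H alpha sigma = Inl ` faceset"
  using nonempty by (simp add: regions_def)

lemma touching_faces:
  assumes "v \<in> vertices H sigma"
  shows "{f \<in> faceset. v \<inter> f \<noteq> {}} = face ` v"
proof
  show "face ` v \<subseteq> {f \<in> faceset. v \<inter> f \<noteq> {}}"
    using vertex_subset[OF assms] orbit_of_refl by fastforce
  show "{f \<in> faceset. v \<inter> f \<noteq> {}} \<subseteq> face ` v"
  proof
    fix f assume f: "f \<in> {f \<in> faceset. v \<inter> f \<noteq> {}}"
    then obtain d where d: "d \<in> v" "d \<in> f" by blast
    obtain y where "f = face y" using f by (blast elim: faceE)
    then have "face d = f" using d(2) by (simp only: ph.in_orbit_of_iff)
    then show "f \<in> face ` v" using d by blast
  qed
qed

lemma game_row: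
  assumes v: "v \<in> vertices H sigma"
  shows "(\<Sum>r\<in>regions H alpha sigma. game_matrix a v r * p r)
    = row (\<lambda>v f. a v (Inl f)) v (\<lambda>f. p (Inl f))"
proof -
  have "(\<Sum>r\<in>regions H alpha sigma. game_matrix a v r * p r)
      = (\<Sum>f\<in>faceset. if v \<inter> f \<noteq> {} then a v (Inl f) * p (Inl f) else 0)"
    unfolding regions_eq by (subst sum.reindex) (auto simp: game_matrix_def intro!: sum.cong)
  also have "\<dots> = (\<Sum>f\<in>{f \<in> faceset. v \<inter> f \<noteq> {}}. a v (Inl f) * p (Inl f))"
    by (simp add: sum.inter_filter)
  finally show ?thesis by (simp only: touching_faces[OF v] row_def)
qed

text \<open>Neighbouring corners never share a region, so two corners in one region are
  opposite.\<close>

lemma reducible_vertex: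
  assumes v: "v \<in> vertices H sigma" and red: "reducible H alpha sigma v"
  obtains x where "x \<in> H" "v = vertex x" "face (sigma (sigma x)) = face x"
proof -
  obtain f where f: "f \<in> faceset" "2 \<le> card (v \<inter> f)"
    using red by (auto simp: reducible_def regions_eq)
  obtain y where y: "f = face y" using f(1) by (rule faceE)
  have in_f: "d \<in> f \<longleftrightarrow> face d = f" for d unfolding y by (rule ph.in_orbit_of_iff)
  have "\<not> v \<inter> f \<subseteq> {d}" for d
    using card_mono[of "{d}" "v \<inter> f"] f(2) by auto
  then obtain d e where d: "d \<in> v" "face d = f" and e: "e \<in> v" "face e = f" "e \<noteq> d"
    using in_f by (metis Int_iff subsetI singletonI empty_subsetI)
  obtain x where x: "x \<in> H" "v = vertex x" using v by (rule vertexE)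
  have dH: "d \<in> H" using vertex_subset[OF v] d(1) by blast
  have vd: "v = vertex d" using d(1) x(2) by (simp only: si.in_orbit_of_iff)
  have "e \<noteq> sigma d" using face_sigma_neq[OF dH] d(2) e(2) by auto
  moreover have "e \<noteq> sigma (sigma (sigma d))"
    using face_sigma_neq[of "sigma (sigma (sigma d))"] dH sigma4[OF dH] d(2) e(2) by auto
  ultimately have "e = sigma (sigma d)" using e(1,3) vertex_eq[OF dH] unfolding vd by simp
  then have "face (sigma (sigma d)) = face d" using d(2) e(2) by simp
  then show ?thesis using that dH vd by blast
qed

lemma side_corners:
  assumes x: "x \<in> H" "face (sigma (sigma x)) = face x"
  shows "vertex x \<inter> face (sigma x) = {sigma x}"
proof -
  have "d \<in> face (sigma x) \<longleftrightarrow> face d = face (sigma x)" for d by (rule ph.in_orbit_of_iff)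
  then show ?thesis unfolding vertex_eq[OF x(1)] using side_faces_neq[OF x] x(2) by auto
qed

text \<open>At an irreducible crossing all increments are congruent to one common non zero divisor,
  which cancels against corner weights equal to 1. The two rows need not be equal, but they vanish
  modulo \<open>k\<close> together.\<close>

lemma game_row_dvd_iff:
  assumes game: "game_version H alpha sigma k a"
  defines "c \<equiv> (\<lambda>v. if reducible H alpha sigma v then (\<lambda>f. a v (Inl f)) else corner_weight v)"
  assumes v: "v \<in> vertices H sigma"
  shows "int k dvd row (\<lambda>v f. a v (Inl f)) v p \<longleftrightarrow> int k dvd row c v p"
proof (cases "reducible H alpha sigma v")
  case True
  then show ?thesis by (simp add: row_def c_def)
next
  case False
  obtain x where x: "x \<in> H" "v = vertex x" using v by (rule vertexE)
  have xv: "x \<in> v" unfolding x(2) by (rule orbit_of_refl)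
  have inc: "Inl (face d) \<in> regions H alpha sigma \<and> incident v (Inl (face d))" if "d \<in> v" for d
  proof -
    have "d \<in> v \<inter> face d" using that orbit_of_refl[of d "sigma \<circ> alpha"] by blast
    moreover have "face d \<in> faceset" using that vertex_subset[OF v] by auto
    ultimately show ?thesis unfolding regions_eq incident.simps by blast
  qed
  let ?t = "a v (Inl (face x))"
  have weight: "corner_weight v f = 1" if f: "f \<in> face ` v" for f
  proof -
    obtain d where d: "d \<in> v" "f = face d" using f by blast
    have "card (v \<inter> f) < 2" using False inc[OF d(1)] d(2) by (force simp: reducible_def not_le)
    moreover have "card (v \<inter> f) \<noteq> 0"
      using inc[OF d(1)] d(2) vertex_eq[OF x(1)] x(2) by simp
    ultimately show ?thesis by (simp add: corner_weight_def)
  qed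
  have same: "int k dvd a v (Inl f) - ?t" if f: "f \<in> face ` v" for f
  proof -
    obtain d where d: "d \<in> v" "f = face d" using f by blast
    show ?thesis
      using game False v inc[OF d(1)] inc[OF xv]
      unfolding game_version_def mod_eq_dvd_iff[symmetric] d(2) by blast
  qed
  have "int k dvd row (\<lambda>v f. a v (Inl f)) v p \<longleftrightarrow> int k dvd (\<Sum>f\<in>face ` v. p f * ?t)"
    unfolding row_def mult.commute[of "a _ _"] using same by (rule sum_dvd_cong)
  also have "(\<Sum>f\<in>face ` v. p f * ?t) = ?t * row c v p"
    using weight False by (simp add: row_def c_def sum_distrib_right mult.commute)
  also have "int k dvd ?t * row c v p \<longleftrightarrow> int k dvd row c v p"
  proof
    have "\<not> zero_divisor_mod k ?t"
      using game False v inc[OF xv] unfolding game_version_def by blast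
    then show "int k dvd row c v p" if "int k dvd ?t * row c v p"
      using that unfolding zero_divisor_mod_def dvd_eq_mod_eq_0 by metis
  qed (rule dvd_mult)
  finally show ?thesis .
qed

text \<open>Each side region of a reducible crossing has a single corner there, so the rule of the
  game for such regions makes its weight cancellable.\<close>

lemma admissible_game:
  assumes game: "game_version H alpha sigma k a"
  shows "admissible (\<lambda>v. if reducible H alpha sigma v then (\<lambda>f. a v (Inl f)) else corner_weight v)"
  unfolding admissible_def
proof (intro ballI impI)
  let ?c = "\<lambda>v. if reducible H alpha sigma v then (\<lambda>f. a v (Inl f)) else corner_weight v"
  fix v assume v: "v \<in> vertices H sigma" and "?c v \<noteq> corner_weight v"
  then have red: "reducible H alpha sigma v" by auto
  then obtain x where x: "x \<in> H" "v = vertex x" "face (sigma (sigma x)) = face x"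
    using reducible_vertex[OF v] by blast
  have nzd: "nonzerodiv (?c v f)" if "f \<in> faceset" "card (v \<inter> f) = 1" for f
  proof -
    have "v \<inter> f \<noteq> {}" using that(2) by auto
    then have "\<not> zero_divisor_mod k (a v (Inl f))"
      using game red v that by (auto simp: game_version_def regions_eq)
    moreover have "?c v f = a v (Inl f)" using red by simp
    ultimately show ?thesis
      unfolding zero_divisor_mod_def nonzerodiv_def dvd_eq_mod_eq_0 by metis
  qed
  have "v \<inter> face (sigma x) = {sigma x}" using side_corners[OF x(1,3)] x(2) by simp
  moreover have "v \<inter> face (sigma (sigma (sigma x))) = {sigma (sigma (sigma x))}"
    using side_corners[of "sigma (sigma x)"] x sigma4[OF x(1)] by simp
  ultimately show "\<exists>x\<in>H. v = vertex x \<and> face (sigma (sigma x)) = face x \<and>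
      nonzerodiv (?c v (face (sigma x))) \<and> nonzerodiv (?c v (face (sigma (sigma (sigma x)))))"
    using x nzd[of "face (sigma x)"] nzd[of "face (sigma (sigma (sigma x)))"]
    by (intro bexI[OF _ x(1)] conjI) simp_all
qed

text \<open>Only the index set changes: regions are faces tagged by \<open>Inl\<close>, and
  extensional patterns on both correspond.\<close>

lemma card_kernel_k:
  assumes game: "game_version H alpha sigma k a"
  shows "card (kernel_k H alpha sigma k a) = k ^ 2"
proof -
  let ?c = "\<lambda>v. if reducible H alpha sigma v then (\<lambda>f. a v (Inl f)) else corner_weight v"
  let ?R = "regions H alpha sigma"
  have mem: "p \<in> kernel_k H alpha sigma k a \<longleftrightarrow>
      p \<in> ?R \<rightarrow>\<^sub>E {0..<int k} \<and> null ?c (\<lambda>f. p (Inl f))" for p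
    using game_row_dvd_iff[OF game] by (simp add: kernel_k_def null_def game_row flip: dvd_eq_mod_eq_0)
  have "bij_betw (\<lambda>p. \<lambda>f\<in>faceset. p (Inl f)) (kernel_k H alpha sigma k a) (kernel ?c)"
  proof (rule bij_betw_byWitness[where f' = "\<lambda>q. \<lambda>r\<in>?R. q (projl r)"])
    show "\<forall>p\<in>kernel_k H alpha sigma k a.
        (\<lambda>r\<in>?R. (\<lambda>f\<in>faceset. p (Inl f)) (projl r)) = p"
    proof
      fix p assume "p \<in> kernel_k H alpha sigma k a"
      then have p: "p \<in> extensional ?R" by (auto simp: mem PiE_def)
      show "(\<lambda>r\<in>?R. (\<lambda>f\<in>faceset. p (Inl f)) (projl r)) = p"
        by (rule extensionalityI[OF restrict_extensional p]) (auto simp: regions_eq)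
    qed
    show "\<forall>q\<in>kernel ?c. (\<lambda>f\<in>faceset. (\<lambda>r\<in>?R. q (projl r)) (Inl f)) = q"
    proof
      fix q assume "q \<in> kernel ?c"
      then have q: "q \<in> extensional faceset" by (auto simp: kernel_def PiE_def)
      show "(\<lambda>f\<in>faceset. (\<lambda>r\<in>?R. q (projl r)) (Inl f)) = q"
        by (rule extensionalityI[OF restrict_extensional q]) (auto simp: regions_eq)
    qed
    have restrict: "null ?c (\<lambda>f\<in>faceset. p f) \<longleftrightarrow> null ?c p" for p
      by (rule null_cong) simp
    show "(\<lambda>p. \<lambda>f\<in>faceset. p (Inl f)) ` kernel_k H alpha sigma k a \<subseteq> kernel ?c"
    proof clarify
      fix p assume "p \<in> kernel_k H alpha sigma k a"
      then show "(\<lambda>f\<in>faceset. p (Inl f)) \<in> kernel ?c"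
        unfolding mem kernel_def regions_eq by (auto simp: restrict dest: PiE_mem)
    qed
    show "(\<lambda>q. \<lambda>r\<in>?R. q (projl r)) ` kernel ?c \<subseteq> kernel_k H alpha sigma k a"
    proof clarify
      fix q assume q: "q \<in> kernel ?c"
      have "null ?c (\<lambda>f. (\<lambda>r\<in>?R. q (projl r)) (Inl f)) \<longleftrightarrow> null ?c q"
        by (rule null_cong) (simp add: regions_eq)
      then have "null ?c (\<lambda>f. (\<lambda>r\<in>?R. q (projl r)) (Inl f))"
        using q unfolding kernel_def by blast
      moreover have "(\<lambda>r\<in>?R. q (projl r)) \<in> ?R \<rightarrow>\<^sub>E {0..<int k}"
        unfolding restrict_PiE_iff using q by (auto simp: kernel_def regions_eq dest: PiE_mem)
      ultimately show "(\<lambda>r\<in>?R. q (projl r)) \<in> kernel_k H alpha sigma k a"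
        unfolding mem by blast
    qed
  qed
  then have "card (kernel_k H alpha sigma k a) = card (kernel ?c)" by (rule bij_betw_same_card)
  also have "\<dots> = k ^ 2" by (rule rigid_card[OF rigid_admissible[OF admissible_game[OF game]]])
  finally show ?thesis .
qed

end

theorem mainTheorem8:
  fixes H :: "'d set" and alpha sigma :: "'d \<Rightarrow> 'd" and k :: nat
    and a :: "'d set \<Rightarrow> ('d set + bool) \<Rightarrow> int"
  assumes "knot_diagram H alpha sigma"
    and "2 \<le> k"
    and "game_version H alpha sigma k a"
  shows "card (kernel_k H alpha sigma k a) = k ^ 2"
proof (cases "H = {}")
  case True
  \<comment> \<open>Without crossings every pattern on the two regions is null.\<close>
  then have "kernel_k H alpha sigma k a = {Inr False, Inr True} \<rightarrow>\<^sub>E {0..<int k}"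
    by (simp add: kernel_k_def regions_def vertices_def orbits_on_def)
  then show ?thesis by (simp add: card_PiE power2_eq_square)
next
  case False
  interpret knot_game H alpha sigma k
    using assms False by unfold_locales
  show ?thesis using card_kernel_k[OF assms(3)] .
qed

end
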